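(* Leafage is not bounded by any function of $f^*$ when $f^*\ge 3$; that is, there is no function $g:\mathbb{N}\to\mathbb{N}$ such that $l(D)\le g(f^*(D))$ for every digraph $D$ with $f^*(D)\ge 3$. In particular, let $E_n$ be the $n$-vertex digraph with adjacency matrix $$A(E_n)=\begin{pmatrix} I & Y\\ Y^T & 0\end{pmatrix},$$ where $I$ is the $(n-1)\times(n-1)$ identity matrix and $Y$ is the column vector of $n-1$ ones. If $n\ge 3$, then $l(E_n)=n$, but $f^*(E_n)=f(E_n)=3$.
   Context: A digraph $D$ is finite with nonempty vertex set $V(D)$, and is identified with a relation $D\subseteq V(D)\times V(D)$ (its set of edges; loops are allowed, no multiple edges). Its adjacency matrix $A(D)$ has entry $1$ in position $(u,v)$ if $uv$ is an edge and $0$ otherwise. $\overline{D}=(V(D)\times V(D))\setminus D$ is its complement. Trees are finite; a leaf is a vertex of degree 1. Subtrees are nonempty connected subgraphs. A subtree representation of $D$ in a host tree $T$ assigns to each vertex $v$ an ordered pair $(S_v,T_v)$ of subtrees of $T$ such that $uv$ is an edge of $D$ if and only if $S_u$ and $T_v$ have a common vertex (for all $u,v\in V(D)$, including $u=v$). The leafage $l(D)$ is the minimum number of leaves of a host tree in which $D$ has a subtree representation. A digraph is a Ferrers digraph if its successor sets $\{u: vu\in E\}$, over all vertices $v$, are linearly ordered by inclusion; equivalently, its adjacency matrix has no $2\times 2$ permutation submatrix (two rows and two columns, not necessarily consecutive). The Ferrers dimension $f(D)$ is the minimum number of Ferrers digraphs on $V(D)$ whose intersection is $D$, equivalently the minimum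 number of Ferrers digraphs on $V(D)$ whose union is $\overline{D}$. $f^*(D)$ is the minimum number of pairwise disjoint Ferrers digraphs on $V(D)$ (as edge sets) whose union is $\overline{D}$. *)

theory Defs
  imports "Jordan_Normal_Form.Matrix" "Graph_Theory.Graph_Theory"
begin

text \<open>Digraphs are pairs of a vertex set and an edge relation; loops are allowed.\<close>

definition finite_nonempty_digraph :: "'a pair_pre_digraph \<Rightarrow> bool" where
  "finite_nonempty_digraph D \<longleftrightarrow> pair_fin_digraph D \<and> pverts D \<noteq> {}"

definition complement_arcs :: "'a pair_pre_digraph \<Rightarrow> 'a rel" where
  "complement_arcs D = pverts D \<times> pverts D - parcs D"

text \<open>
  Undirected graphs are represented as symmetric loop-free digraphs (\<^locale>\<open>pair_graph\<close>).
  The constant \<^const>\<open>tree\<close> of the library is of no use for them: it excludes all directed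
  cycles, and in a symmetric digraph every edge gives a directed cycle of length 2.  The cycles
  of an undirected graph are exactly the directed cycles of length at least 3.
\<close>

definition undirected_tree :: "'t pair_pre_digraph \<Rightarrow> bool" where
  "undirected_tree T \<longleftrightarrow>
     pair_graph T \<and> Digraph_Component.connected (with_proj T) \<and>
     \<not> (\<exists>p. pre_digraph.cycle (with_proj T) p \<and> 3 \<le> length p)"

text \<open>In a symmetric digraph the out-degree of a vertex is its degree as an undirected graph.\<close>

definition leaves :: "'t pair_pre_digraph \<Rightarrow> 't set" where
  "leaves T = {x \<in> pverts T. out_degree (with_proj T) x = 1}"

text \<open>Connectedness in the library includes having at least one vertex.\<close>

definition subtree_of :: "'t pair_pre_digraph \<Rightarrow> 't pair_pre_digraph \<Rightarrow> bool" where
  "subtree_of H T \<longleftrightarrow>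
     pair_graph H \<and> subgraph (with_proj H) (with_proj T) \<and>
     Digraph_Component.connected (with_proj H)"

definition subtree_representation ::
  "'a pair_pre_digraph \<Rightarrow> 't pair_pre_digraph \<Rightarrow>
   ('a \<Rightarrow> 't pair_pre_digraph) \<Rightarrow> ('a \<Rightarrow> 't pair_pre_digraph) \<Rightarrow> bool" where
  "subtree_representation D T S S' \<longleftrightarrow>
     (\<forall>v\<in>pverts D. subtree_of (S v) T \<and> subtree_of (S' v) T) \<and>
     (\<forall>u\<in>pverts D. \<forall>v\<in>pverts D. (u, v) \<in> parcs D \<longleftrightarrow> pverts (S u) \<inter> pverts (S' v) \<noteq> {})"

text \<open>
  Since host trees are finite, it is no restriction to take their vertices in \<^typ>\<open>nat\<close>.
  A one-vertex tree has no leaves.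
\<close>

definition leafage :: "'a pair_pre_digraph \<Rightarrow> nat" where
  "leafage D = (LEAST k. \<exists>(T :: nat pair_pre_digraph) S S'.
     undirected_tree T \<and> card (leaves T) = k \<and> subtree_representation D T S S')"

definition ferrers_digraph_on :: "'a set \<Rightarrow> 'a rel \<Rightarrow> bool" where
  "ferrers_digraph_on V F \<longleftrightarrow>
     F \<subseteq> V \<times> V \<and> (\<forall>u\<in>V. \<forall>v\<in>V. F `` {u} \<subseteq> F `` {v} \<or> F `` {v} \<subseteq> F `` {u})"

text \<open>
  Intersections are taken inside \<open>V \<times> V\<close>, so that the empty intersection is the complete
  digraph with loops, in accordance with the empty union for the complement.
\<close>

definition ferrers_dim :: "'a pair_pre_digraph \<Rightarrow> nat" where
  "ferrers_dim D = (LEAST k. \<exists>\<F>. finite \<F> \<and> card \<F> = k \<and>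
     (\<forall>F\<in>\<F>. ferrers_digraph_on (pverts D) F) \<and>
     (pverts D \<times> pverts D) \<inter> \<Inter>\<F> = parcs D)"

definition disjoint_ferrers_dim :: "'a pair_pre_digraph \<Rightarrow> nat" where
  "disjoint_ferrers_dim D = (LEAST k. \<exists>\<F>. finite \<F> \<and> card \<F> = k \<and>
     (\<forall>F\<in>\<F>. ferrers_digraph_on (pverts D) F) \<and>
     pairwise disjnt \<F> \<and> \<Union>\<F> = complement_arcs D)"

definition adjacency_matrix :: "nat \<Rightarrow> nat rel \<Rightarrow> int mat" where
  "adjacency_matrix n R = mat n n (\<lambda>(u, v). if (u, v) \<in> R then 1 else 0)"

definition E_matrix :: "nat \<Rightarrow> int mat" where
  "E_matrix n =
     (let Y = mat (n - 1) 1 (\<lambda>_. 1)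
      in four_block_mat (1\<^sub>m (n - 1)) Y (transpose_mat Y) (0\<^sub>m 1 1))"

text \<open>The vertices are numbered from 0, so \<open>n - 1\<close> is the vertex of the last row and column.\<close>

definition E_digraph :: "nat \<Rightarrow> nat pair_pre_digraph" where
  "E_digraph n =
     \<lparr> pverts = {..<n}, parcs = {(u, v). u < n \<and> v < n \<and> E_matrix n $$ (u, v) = 1} \<rparr>"

lemma adjacency_matrix_E_digraph:
  assumes "1 \<le> n"
  shows "adjacency_matrix n (parcs (E_digraph n)) = E_matrix n"
  using assms
  by (intro eq_matI)
    (auto simp: adjacency_matrix_def E_digraph_def E_matrix_def Let_def)

lemma finite_nonempty_E_digraph:
  assumes "1 \<le> n"
  shows "finite_nonempty_digraph (E_digraph n)"
proof -
  have "parcs (E_digraph n) \<subseteq> {..<n} \<times> {..<n}"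
    by (auto simp: E_digraph_def)
  then have "finite (parcs (E_digraph n))"
    by (rule finite_subset) simp
  then have "pair_fin_digraph (E_digraph n)"
    by unfold_locales (auto simp: E_digraph_def)
  then show ?thesis
    using assms by (auto simp: finite_nonempty_digraph_def E_digraph_def lessThan_empty_iff)
qed

end

(* Lower bound: let S_i, T_i represent the vertices of E_n, let z be the last vertex, and for i < z
   pick p_i in S_i and T_i.  In a tree some point s of S_z lies in every subtree meeting both S_z
   and T_z, hence in S_i or T_i for every i.  As S_i and T_j are disjoint for i different from j,
   s lies in all the T_i or in all the S_i.  In the first case the union of T_z and the S_i joins
   the p_i while avoiding s, and the union of the T_j with j different from i joins s to the other
   p_j while avoiding p_i; in the second case a point of T_z plays the role of s with the two
   families swapped.  So none of these n points separates the others, and a tree with n such points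
   has at least n leaves.  The star with n leaves attains the bound.

   Ferrers dimension: the entries (0,1), (1,0), (z,z) of the complement are pairwise in conflict,
   so three Ferrers digraphs are needed; the strict upper and lower triangles of the first block
   and the corner suffice. *)

theory Submission
  imports Defs
begin

section \<open>Connectedness of vertex sets\<close>

text \<open>A cut condition instead of walks makes unions and deletions of leaves easy. The edges
  are those of the host between points of \<open>X\<close>, so that a subtree can be given by its
  vertices alone.\<close>

definition connected_in :: "'t rel \<Rightarrow> 't set \<Rightarrow> bool" where
  "connected_in E X \<longleftrightarrow>
     X \<noteq> {} \<and> (\<forall>A. A \<subset> X \<longrightarrow> A \<noteq> {} \<longrightarrow> (\<exists>a\<in>A. \<exists>b\<in>X - A. (a, b) \<in> E))"

lemma connected_inD:
  assumes "connected_in E X" "A \<subseteq> X" "a \<in> A" "b \<in> X" "b \<notin> A"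
  obtains x y where "x \<in> A" "y \<in> X" "y \<notin> A" "(x, y) \<in> E"
  using assms unfolding connected_in_def by (metis DiffE empty_iff psubsetI)

lemma connected_in_mono: "connected_in E X \<Longrightarrow> E \<subseteq> F \<Longrightarrow> connected_in F X"
  unfolding connected_in_def by (meson subsetD)

lemma connected_in_Union:
  assumes "\<X> \<noteq> {}" "\<And>X. X \<in> \<X> \<Longrightarrow> connected_in E X \<and> q \<in> X"
    and sym: "sym E"
  shows "connected_in E (\<Union>\<X>)"
  unfolding connected_in_def
proof (intro conjI allI impI)
  show "\<Union>\<X> \<noteq> {}" using assms by blast
  fix A assume A: "A \<subset> \<Union>\<X>" "A \<noteq> {}"
  show "\<exists>a\<in>A. \<exists>b\<in>\<Union>\<X> - A. (a, b) \<in> E"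
  proof (cases "q \<in> A")
    case True
    from A obtain b X where "X \<in> \<X>" "b \<in> X" "b \<notin> A" by blast
    then show ?thesis
      using connected_inD[of E X "A \<inter> X" q b] assms(2)[of X] True by blast
  next
    case False
    from A obtain a X where "X \<in> \<X>" "a \<in> X" "a \<in> A" by blast
    then show ?thesis
      using connected_inD[of E X "A \<inter> X" a q] assms(2)[of X] False by blast
  qed
qed

lemma connected_in_Un:
  assumes "connected_in E X" "connected_in E Y" "X \<inter> Y \<noteq> {}" "sym E"
  shows "connected_in E (X \<union> Y)"
proof -
  from assms(3) obtain q where "q \<in> X" "q \<in> Y" by blast
  then show ?thesis
    using connected_in_Union[of "{X, Y}" E q] assms by auto
qed

lemma connected_in_neighbour:
  assumes "connected_in E X" "v \<in> X" "x \<in> X" "x \<noteq> v"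
  obtains w where "w \<in> X" "w \<noteq> v" "(v, w) \<in> E"
  using connected_inD[OF assms(1), of "{v}" v x] assms by blast

text \<open>For a cut \<open>A\<close> of \<open>X - {v}\<close>, put \<open>v\<close> on the side
  of its neighbour \<open>u\<close>; the edge of \<open>X\<close> that crosses this cut cannot use
  \<open>v\<close>.\<close>

lemma connected_in_delete_leaf:
  assumes X: "connected_in E X" and sym: "sym E"
    and u: "\<And>w. w \<in> X \<Longrightarrow> (w, v) \<in> E \<Longrightarrow> w = u"
    and ne: "X - {v} \<noteq> {}"
  shows "connected_in E (X - {v})"
  unfolding connected_in_def
proof (intro conjI allI impI ne)
  fix A assume A: "A \<subset> X - {v}" "A \<noteq> {}"
  from A obtain a b where ab: "a \<in> A" "b \<in> X" "b \<noteq> v" "b \<notin> A" by blast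
  show "\<exists>a\<in>A. \<exists>b\<in>X - {v} - A. (a, b) \<in> E"
  proof (cases "u \<in> A")
    case True
    obtain x y where "x \<in> insert v A \<inter> X" "y \<in> X" "y \<notin> insert v A \<inter> X" "(x, y) \<in> E"
      using connected_inD[OF X, of "insert v A \<inter> X" a b] A ab by blast
    then show ?thesis using u True symD[OF sym] by blast
  next
    case False
    obtain x y where "x \<in> A" "y \<in> X" "y \<notin> A" "(x, y) \<in> E"
      using connected_inD[OF X, of A a b] A ab by blast
    then show ?thesis using u False A by blast
  qed
qed

section \<open>Trees grown by leaves, and gates between disjoint subtrees\<close>

text \<open>Trees are handled as sets built up from a vertex by attaching leaves.\<close>

inductive grown :: "'t rel \<Rightarrow> 't set \<Rightarrow> bool" for E where
  single: "grown E {x}"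
| attach: "grown E W \<Longrightarrow> u \<in> W \<Longrightarrow> v \<notin> W \<Longrightarrow> (u, v) \<in> E \<Longrightarrow>
    (\<And>w. w \<in> W \<Longrightarrow> (w, v) \<in> E \<Longrightarrow> w = u) \<Longrightarrow> grown E (insert v W)"

definition leaves_in :: "'t rel \<Rightarrow> 't set \<Rightarrow> 't set" where
  "leaves_in E W = {x \<in> W. \<exists>!y. y \<in> W \<and> (x, y) \<in> E}"

lemma grown_finite: "grown E W \<Longrightarrow> finite W"
  by (induction rule: grown.induct) auto

text \<open>\<open>s\<close> is the end in \<open>P\<close> of the path of the tree from
  \<open>P\<close> to \<open>Q\<close>. The induction removes the last attached leaf
  \<open>v\<close> from \<open>P\<close>, \<open>Q\<close> and \<open>X\<close>; only
  \<open>P\<close> or \<open>Q\<close> equal to \<open>{v}\<close> needs separate care.\<close>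

lemma bridge:
  assumes "grown E W" and sym: "sym E" and irr: "irrefl E"
    and "connected_in E P" "connected_in E Q" "P \<subseteq> W" "Q \<subseteq> W" "P \<inter> Q = {}"
  shows "\<exists>s\<in>P. \<forall>X. connected_in E X \<longrightarrow> X \<subseteq> W \<longrightarrow> X \<inter> P \<noteq> {} \<longrightarrow> X \<inter> Q \<noteq> {} \<longrightarrow> s \<in> X"
  using assms(1,4-)
proof (induction arbitrary: P Q rule: grown.induct)
  case (single x)
  then have "P = {x}" "Q = {x}" by (auto simp: connected_in_def)
  with single show ?case by simp
next
  case (attach W u v)
  have uniq: "w = u" if "w \<in> insert v W" "(w, v) \<in> E" for w
    using that attach.hyps(5) irr by (auto simp: irrefl_def)
  have del: "connected_in E (X - {v})" "X - {v} \<subseteq> W"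
    if "connected_in E X" "X \<subseteq> insert v W" "X \<noteq> {v}" for X
  proof -
    have "X \<noteq> {}" using that(1) by (auto simp: connected_in_def)
    then have "X - {v} \<noteq> {}" using that by blast
    then show "connected_in E (X - {v})"
      using connected_in_delete_leaf[OF that(1) sym, of v u] uniq that by blast
  qed (use that in blast)
  have nb: "u \<in> X" if X: "connected_in E X" "X \<subseteq> insert v W" "v \<in> X" "X \<noteq> {v}" for X
  proof -
    obtain x where "x \<in> X" "x \<noteq> v" using X by blast
    then obtain w where "w \<in> X" "(v, w) \<in> E"
      using connected_in_neighbour[OF X(1,3)] by metis
    then show ?thesis using uniq[of w] symD[OF sym] X by blast
  qed
  have uv: "u \<noteq> v" using attach by blast
  have single_u: "connected_in E {u}"
    by (auto simp: connected_in_def)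
  consider "P = {v}" | "Q = {v}" "u \<in> P" | "Q = {v}" "u \<notin> P" | "P \<noteq> {v}" "Q \<noteq> {v}" by blast
  then show ?case
  proof cases
    case 1
    then show ?thesis by blast
  next
    case 2
    have "u \<in> X" if "connected_in E X" "X \<subseteq> insert v W" "X \<inter> P \<noteq> {}" "X \<inter> Q \<noteq> {}" for X
      using nb[of X] that 2 attach.prems by blast
    then show ?thesis using 2 by blast
  next
    \<comment> \<open>The singleton \<open>Q = {v}\<close> is replaced by \<open>{u}\<close>: a
      connected set that contains \<open>v\<close> and meets \<open>P\<close> contains
      \<open>u\<close> as well.\<close>
    case 3
    have P: "P \<subseteq> W" using 3 attach.prems by blast
    obtain s where s: "s \<in> P" "\<And>X. connected_in E X \<Longrightarrow> X \<subseteq> W \<Longrightarrow> X \<inter> P \<noteq> {} \<Longrightarrow> u \<in> X \<Longrightarrow> s \<in> X"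
      using attach.IH[of P "{u}"] single_u P 3 attach.prems attach.hyps(2) by auto
    have "s \<in> X" if X: "connected_in E X" "X \<subseteq> insert v W" "X \<inter> P \<noteq> {}" "X \<inter> Q \<noteq> {}" for X
    proof -
      have "v \<in> X" "X \<noteq> {v}" using X 3 attach.prems by blast+
      then have "u \<in> X" using nb X by blast
      then have "u \<in> X - {v}" using uv by blast
      moreover have "(X - {v}) \<inter> P \<noteq> {}" using X 3 attach.prems by blast
      ultimately show ?thesis using s(2)[of "X - {v}"] del[of X] X \<open>X \<noteq> {v}\<close> by blast
    qed
    then show ?thesis using s(1) by blast
  next
    case 4
    note dP = del[OF attach.prems(1,3) 4(1)] and dQ = del[OF attach.prems(2,4) 4(2)]
    obtain s where s: "s \<in> P - {v}" "\<And>X. connected_in E X \<Longrightarrow> X \<subseteq> W \<Longrightarrow> X \<inter> (P - {v}) \<noteq> {} \<Longrightarrow>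
       X \<inter> (Q - {v}) \<noteq> {} \<Longrightarrow> s \<in> X"
      using attach.IH[OF dP(1) dQ(1) dP(2) dQ(2)] attach.prems(5) by blast
    have "s \<in> X" if X: "connected_in E X" "X \<subseteq> insert v W" "X \<inter> P \<noteq> {}" "X \<inter> Q \<noteq> {}" for X
    proof -
      have ne: "X \<noteq> {v}" using X attach.prems(5) by blast
      \<comment> \<open>Removing \<open>v\<close> keeps the intersections: if \<open>X\<close> and
        \<open>R\<close> share \<open>v\<close> and neither is \<open>{v}\<close>, both contain
        \<open>u\<close>.\<close>
      have meet: "(X - {v}) \<inter> (R - {v}) \<noteq> {}"
        if R: "connected_in E R" "R \<subseteq> insert v W" "R \<noteq> {v}" "X \<inter> R \<noteq> {}" for R
      proof (cases "v \<in> X \<and> v \<in> R")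
        case True
        then show ?thesis using nb[of X] nb[of R] X R ne uv by blast
      next
        case False
        then show ?thesis using R by blast
      qed
      show ?thesis
        using s(2)[of "X - {v}"] del[of X] X ne meet[of P] meet[of Q] attach.prems 4 by blast
    qed
    then show ?thesis using s(1) by blast
  qed
qed

section \<open>Independent points and the number of leaves\<close>

text \<open>No point of \<open>P\<close> separates two others.\<close>

definition independent_in :: "'t rel \<Rightarrow> 't set \<Rightarrow> 't set \<Rightarrow> bool" where
  "independent_in E W P \<longleftrightarrow> P \<subseteq> W \<and>
     (\<forall>k\<in>P. \<exists>X. connected_in E X \<and> X \<subseteq> W \<and> P - {k} \<subseteq> X \<and> k \<notin> X)"

text \<open>Among the old vertices only \<open>u\<close> gets a new neighbour, so no other leaf can
  be lost.\<close>

lemma leaves_in_insert: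
  assumes sym: "sym E" and irr: "irrefl E" and "u \<in> W" "v \<notin> W" "(u, v) \<in> E"
    "\<And>w. w \<in> W \<Longrightarrow> (w, v) \<in> E \<Longrightarrow> w = u"
  shows "insert v (leaves_in E W - {u}) \<subseteq> leaves_in E (insert v W)"
proof
  fix x assume x: "x \<in> insert v (leaves_in E W - {u})"
  have vu: "(v, u) \<in> E" using assms symD[OF sym] by blast
  have vw: "w = u" if "w \<in> insert v W" "(v, w) \<in> E" for w
    using that assms symD[OF sym] by (metis insert_iff irrefl_def)
  show "x \<in> leaves_in E (insert v W)"
  proof (cases "x = v")
    case True
    then show ?thesis using vu vw assms(3) unfolding leaves_in_def by auto
  next
    case False
    with x have "x \<in> W" "x \<noteq> u" and ex: "\<exists>!y. y \<in> W \<and> (x, y) \<in> E" unfolding leaves_in_def by auto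
    then have "(x, v) \<notin> E" using assms(6) by blast
    with ex have "\<exists>!y. y \<in> insert v W \<and> (x, y) \<in> E" by (metis insert_iff)
    then show ?thesis using \<open>x \<in> W\<close> unfolding leaves_in_def by blast
  qed
qed

text \<open>The new leaf \<open>v\<close> makes up for the loss of \<open>u\<close>, and is a gain
  if \<open>u\<close> was no leaf.\<close>

lemma card_leaves_in_insert:
  assumes g: "grown E W" and sym: "sym E" and irr: "irrefl E" and a: "u \<in> W" "v \<notin> W" "(u, v) \<in> E"
    "\<And>w. w \<in> W \<Longrightarrow> (w, v) \<in> E \<Longrightarrow> w = u"
  shows "card (leaves_in E W) \<le> card (leaves_in E (insert v W))"
    and "u \<notin> leaves_in E W \<Longrightarrow> card (leaves_in E W) < card (leaves_in E (insert v W))"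
proof -
  have fin: "finite (leaves_in E (insert v W))" "finite (leaves_in E W)"
    using grown_finite[OF g] by (auto simp: leaves_in_def)
  have v: "v \<notin> leaves_in E W" using a by (auto simp: leaves_in_def)
  have c: "card (insert v (leaves_in E W - {u})) \<le> card (leaves_in E (insert v W))"
    by (rule card_mono[OF fin(1) leaves_in_insert[OF sym irr a]])
  then show "card (leaves_in E W) \<le> card (leaves_in E (insert v W))"
    using fin v by (cases "u \<in> leaves_in E W") (auto simp: card_Diff_singleton)
  show "card (leaves_in E W) < card (leaves_in E (insert v W))" if "u \<notin> leaves_in E W"
    using c fin v that by auto
qed

lemma two_leaves_in:
  assumes "grown E W" and sym: "sym E" and irr: "irrefl E" and "x \<in> W" "y \<in> W" "x \<noteq> y"
  shows "2 \<le> card (leaves_in E W)"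
  using assms(1,4-)
proof (induction arbitrary: x y rule: grown.induct)
  case (attach W u v)
  show ?case
  \<comment> \<open>The single vertex where the growth starts has no neighbour and is no leaf, so
    the first attachment is treated by itself.\<close>
  proof (cases "W = {u}")
    case True
    have e: "(u, u) \<notin> E" "(v, v) \<notin> E" "(u, v) \<in> E" "(v, u) \<in> E"
      using irr attach.hyps(4) symD[OF sym attach.hyps(4)] by (auto simp: irrefl_def)
    have "u \<in> leaves_in E {v, u}" "v \<in> leaves_in E {v, u}"
      unfolding leaves_in_def using e by blast+
    then have "leaves_in E (insert v W) = {u, v}"
      using True by (auto simp: leaves_in_def)
    then show ?thesis using True attach.hyps(3) by simp
  next
    case False
    then obtain w where "w \<in> W" "w \<noteq> u" using attach.hyps by blast
    then have "2 \<le> card (leaves_in E W)" using attach.IH attach.hyps by blast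
    also have "\<dots> \<le> card (leaves_in E (insert v W))"
      using card_leaves_in_insert(1)[OF attach.hyps(1) sym irr attach.hyps(2-5)] by blast
    finally show ?thesis .
  qed
qed auto

text \<open>Induction on the last attached leaf \<open>v\<close>. If it is outside \<open>P\<close>,
  or if its attachment gains a leaf, the bound for \<open>P - {v}\<close> suffices; otherwise its
  place in \<open>P\<close> is taken by its neighbour \<open>u\<close>.\<close>

lemma card_independent_in:
  assumes "grown E W" and sym: "sym E" and irr: "irrefl E"
    and "independent_in E W P" "x \<in> W" "y \<in> W" "x \<noteq> y"
  shows "card P \<le> card (leaves_in E W)"
  using assms(1,4-)
proof (induction arbitrary: P x y rule: grown.induct)
  case (attach W u v)
  note card_le = card_leaves_in_insert[OF attach.hyps(1) sym irr attach.hyps(2-5)]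
  have uniq: "w = u" if "w \<in> insert v W" "(w, v) \<in> E" for w
    using that attach.hyps(5) irr by (auto simp: irrefl_def)
  have del: "connected_in E (X - {v})"
    if "connected_in E X" "X \<subseteq> insert v W" "X - {v} \<noteq> {}" for X
    using connected_in_delete_leaf[OF that(1) sym, of v u] uniq that by blast
  have nb: "u \<in> X" if X: "connected_in E X" "X \<subseteq> insert v W" "v \<in> X" "x \<in> X" "x \<noteq> v" for X x
  proof -
    obtain w where "w \<in> X" "(v, w) \<in> E"
      using connected_in_neighbour[OF X(1,3-5)] by metis
    then show ?thesis using uniq[of w] symD[OF sym] X by blast
  qed
  have sub: "P \<subseteq> insert v W"
    and ind: "\<And>k. k \<in> P \<Longrightarrow> \<exists>X. connected_in E X \<and> X \<subseteq> insert v W \<and> P - {k} \<subseteq> X \<and> k \<notin> X"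
    using attach.prems(1) unfolding independent_in_def by auto
  have finP: "finite P" using sub grown_finite[OF attach.hyps(1)] finite_subset by auto
  have uv: "u \<noteq> v" using attach.hyps by blast
  show ?case
  \<comment> \<open>With three points in \<open>P\<close> there is always one besides the two under
    discussion; it keeps the shrunken sets nonempty and forces sets through \<open>v\<close> to
    contain \<open>u\<close>.\<close>
  proof (cases "card P \<le> 2")
    case True
    also have "2 \<le> card (leaves_in E (insert v W))"
      using two_leaves_in[OF grown.attach[OF attach.hyps(1-5)] sym irr attach.prems(2-)] .
    finally show ?thesis .
  next
    case False
    have third: "\<exists>z\<in>P. z \<noteq> a \<and> z \<noteq> b" for a b
    proof (rule ccontr)
      assume "\<not> ?thesis"
      then have "P \<subseteq> {a, b}" by blast
      then have "card P \<le> card {a, b}" by (intro card_mono) auto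
      also have "\<dots> \<le> 2" by (simp add: card_insert_if)
      finally show False using False by simp
    qed
    have W2: "\<exists>a b. a \<in> W \<and> b \<in> W \<and> a \<noteq> b"
      using third[of v v] third[of v] sub by (metis insertE subsetD)
    have "\<exists>X. connected_in E X \<and> X \<subseteq> W \<and> P - {v} - {k} \<subseteq> X \<and> k \<notin> X" if k: "k \<in> P - {v}" for k
    proof -
      obtain X where X: "connected_in E X" "X \<subseteq> insert v W" "P - {k} \<subseteq> X" "k \<notin> X"
        using ind k by blast
      obtain z where "z \<in> P" "z \<noteq> k" "z \<noteq> v" using third by blast
      then have "X - {v} \<noteq> {}" using X by blast
      then have "connected_in E (X - {v})" using del X by blast
      then show ?thesis using X by (intro exI[of _ "X - {v}"]) blast
    qed
    then have indv: "independent_in E W (P - {v})"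
      unfolding independent_in_def using sub by blast
    have IH: "card R \<le> card (leaves_in E W)" if "independent_in E W R" for R
      using attach.IH[OF that] W2 by blast
    show ?thesis
    proof (cases "v \<in> P")
      case False
      then show ?thesis using IH[OF indv] card_le(1) by simp
    next
      case vP: True
      \<comment> \<open>\<open>u\<close> separates \<open>v\<close> from the rest of
        \<open>P\<close>: a connected set through \<open>v\<close> and a third point of
        \<open>P\<close> cannot avoid \<open>u\<close>.\<close>
      have uP: "u \<notin> P"
      proof
        assume "u \<in> P"
        then obtain X where X: "connected_in E X" "X \<subseteq> insert v W" "P - {u} \<subseteq> X" "u \<notin> X"
          using ind by blast
        obtain z where "z \<in> P" "z \<noteq> u" "z \<noteq> v" using third by blast
        then show False using nb[OF X(1,2), of z] X vP uv by blast
      qed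
      show ?thesis
      proof (cases "u \<in> leaves_in E W")
        case False
        then show ?thesis using IH[OF indv] card_le(2) finP vP
          by (simp add: card_Diff_singleton)
      next
        case True \<comment> \<open>no leaf is gained, so \<open>v\<close> has to be replaced by \<open>u\<close> in \<open>P\<close>\<close>
        then obtain w where w: "\<And>y. y \<in> W \<Longrightarrow> (u, y) \<in> E \<Longrightarrow> y = w"
          unfolding leaves_in_def by blast
        have "\<exists>X. connected_in E X \<and> X \<subseteq> W \<and> insert u (P - {v}) - {k} \<subseteq> X \<and> k \<notin> X"
          if k: "k \<in> insert u (P - {v})" for k
        proof (cases "k = u")
          case True
          \<comment> \<open>The set that avoids \<open>v\<close> loses \<open>u\<close> as well; it
            remains connected because \<open>u\<close> is a leaf of \<open>W\<close>.\<close>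
          obtain X where X: "connected_in E X" "X \<subseteq> insert v W" "P - {v} \<subseteq> X" "v \<notin> X"
            using ind vP by blast
          obtain z where "z \<in> P" "z \<noteq> u" "z \<noteq> v" using third by blast
          then have "X - {u} \<noteq> {}" using X by blast
          then have "connected_in E (X - {u})"
            using connected_in_delete_leaf[OF X(1) sym, of u w] w X symD[OF sym] by blast
          then show ?thesis using X True uP by (intro exI[of _ "X - {u}"]) blast
        next
          case False
          then obtain X where X: "connected_in E X" "X \<subseteq> insert v W" "P - {k} \<subseteq> X" "k \<notin> X"
            using ind k by blast
          obtain z where z: "z \<in> P" "z \<noteq> k" "z \<noteq> v" using third by blast
          \<comment> \<open>The set through \<open>v\<close> also contains \<open>u\<close>, so it
            may lose \<open>v\<close> and serves for the exchanged family.\<close>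
          have "v \<in> X" using X vP k False uv by blast
          then have "u \<in> X" using nb[OF X(1,2), of z] z X by blast
          moreover have "X - {v} \<noteq> {}" using z X by blast
          then have "connected_in E (X - {v})" using del X by blast
          ultimately show ?thesis using X uv by (intro exI[of _ "X - {v}"]) blast
        qed
        then have "independent_in E W (insert u (P - {v}))"
          unfolding independent_in_def using sub attach.hyps(2) by blast
        from IH[OF this] show ?thesis
          using card_le(1) finP vP uP by (simp add: card_Suc_Diff1)
      qed
    qed
  qed
qed auto

section \<open>Lower bound from the intersection pattern of the subtrees\<close>

text \<open>One family has the common point \<open>s\<close>, the other is joined by
  \<open>Q\<close>. Both cases of the lower bound are instances, with the families exchanged in one
  of them.\<close>

lemma leaves_lower_bound_aux:
  fixes S S' :: "nat \<Rightarrow> 't set"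
  assumes g: "grown E W" and sym: "sym E" and irr: "irrefl E" and m: "2 \<le> m"
    and S: "\<And>i. i < m \<Longrightarrow> connected_in E (S i) \<and> S i \<subseteq> W"
    and S': "\<And>i. i < m \<Longrightarrow> connected_in E (S' i) \<and> S' i \<subseteq> W"
    and Q: "connected_in E Q" "Q \<subseteq> W"
    and meet: "\<And>i j. i < m \<Longrightarrow> j < m \<Longrightarrow> S i \<inter> S' j \<noteq> {} \<longleftrightarrow> i = j"
    and SQ: "\<And>i. i < m \<Longrightarrow> S i \<inter> Q \<noteq> {}"
    and s: "\<And>i. i < m \<Longrightarrow> s \<in> S' i" "\<And>i. i < m \<Longrightarrow> s \<notin> S i" "s \<notin> Q"
  shows "Suc m \<le> card (leaves_in E W)"
proof -
  have "\<forall>i<m. \<exists>x. x \<in> S i \<and> x \<in> S' i" using meet by blast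
  then obtain p where p: "\<And>i. i < m \<Longrightarrow> p i \<in> S i \<and> p i \<in> S' i" by metis
  have inj: "inj_on p {..<m}"
    using p meet by (intro inj_onI) (metis IntI empty_iff lessThan_iff)
  have sp: "s \<notin> p ` {..<m}" using p s by auto
  let ?P = "insert s (p ` {..<m})"
  have sub: "?P \<subseteq> W" using p s(1)[of 0] S S' m by fastforce
  have "\<exists>X. connected_in E X \<and> X \<subseteq> W \<and> ?P - {k} \<subseteq> X \<and> k \<notin> X" if k: "k \<in> ?P" for k
  proof (cases "k = s")
    case True
    obtain q where q: "q \<in> Q" using Q by (auto simp: connected_in_def)
    \<comment> \<open>Each \<open>S i\<close> meets \<open>Q\<close>, so the sets
      \<open>Q \<union> S i\<close> are connected and share \<open>q\<close>.\<close>
    have "connected_in E (\<Union>((\<lambda>i. Q \<union> S i) ` {..<m}))"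
      using m S Q SQ q by (intro connected_in_Union[of _ _ q] conjI)
        (auto simp: lessThan_empty_iff Int_commute intro!: connected_in_Un sym)
    moreover have "\<Union>((\<lambda>i. Q \<union> S i) ` {..<m}) \<subseteq> W" using S Q by blast
    moreover have "?P - {k} \<subseteq> \<Union>((\<lambda>i. Q \<union> S i) ` {..<m})" using True p by blast
    moreover have "k \<notin> \<Union>((\<lambda>i. Q \<union> S i) ` {..<m})" using True s by blast
    ultimately show ?thesis by blast
  next
    case False
    then obtain j where j: "j < m" "k = p j" using k by auto
    let ?I = "{..<m} - {j}"
    have ne: "?I \<noteq> {}"
    proof -
      have "(if j = 0 then 1 else 0) \<in> ?I" using m by auto
      then show ?thesis by blast
    qed
    have "connected_in E (\<Union>(S' ` ?I))"
      using ne S' s by (intro connected_in_Union[of _ _ s]) (auto intro: sym)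
    \<comment> \<open>\<open>p j\<close> lies in \<open>S j\<close>, which is disjoint from every
      \<open>S' i\<close> with \<open>i\<close> different from \<open>j\<close>.\<close>
    moreover have "p j \<notin> \<Union>(S' ` ?I)" using p meet j by blast
    moreover have "s \<in> \<Union>(S' ` ?I)" using ne s by blast
    moreover have "?P - {k} \<subseteq> insert s (\<Union>(S' ` ?I))" using p j by blast
    moreover have "\<Union>(S' ` ?I) \<subseteq> W" using S' by blast
    ultimately show ?thesis unfolding j(2) by (metis insert_absorb)
  qed
  then have "independent_in E W ?P" using sub unfolding independent_in_def by blast
  moreover have "p 0 \<in> W" "s \<in> W" "p 0 \<noteq> s" using sub sp m by auto
  ultimately have "card ?P \<le> card (leaves_in E W)"
    using card_independent_in[OF g sym irr] by blast
  then show ?thesis using sp inj by (simp add: card_image)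
qed

lemma leaves_lower_bound:
  fixes S S' :: "nat \<Rightarrow> 't set"
  assumes g: "grown E W" and sym: "sym E" and irr: "irrefl E" and m: "2 \<le> m"
    and S: "\<And>i. i \<le> m \<Longrightarrow> connected_in E (S i) \<and> S i \<subseteq> W"
    and S': "\<And>i. i \<le> m \<Longrightarrow> connected_in E (S' i) \<and> S' i \<subseteq> W"
    and meet: "\<And>i j. i < m \<Longrightarrow> j < m \<Longrightarrow> S i \<inter> S' j \<noteq> {} \<longleftrightarrow> i = j"
    and Sm: "\<And>i. i < m \<Longrightarrow> S i \<inter> S' m \<noteq> {}"
    and S'm: "\<And>i. i < m \<Longrightarrow> S' i \<inter> S m \<noteq> {}"
    and disj: "S m \<inter> S' m = {}"
  shows "Suc m \<le> card (leaves_in E W)"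
proof -
  obtain s where s: "s \<in> S m"
    "\<And>X. connected_in E X \<Longrightarrow> X \<subseteq> W \<Longrightarrow> X \<inter> S m \<noteq> {} \<Longrightarrow> X \<inter> S' m \<noteq> {} \<Longrightarrow> s \<in> X"
    using bridge[OF g sym irr, of "S m" "S' m"] S[of m] S'[of m] disj by blast
  obtain t where t: "t \<in> S' m"
    "\<And>X. connected_in E X \<Longrightarrow> X \<subseteq> W \<Longrightarrow> X \<inter> S m \<noteq> {} \<Longrightarrow> X \<inter> S' m \<noteq> {} \<Longrightarrow> t \<in> X"
  proof -
    have "S' m \<inter> S m = {}" using disj by blast
    then show ?thesis
      using bridge[OF g sym irr, of "S' m" "S m"] S[of m] S'[of m] that by auto
  qed
  \<comment> \<open>As \<open>S i\<close> and \<open>S' i\<close> meet, their union is connected; it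
    meets \<open>S' m\<close> through \<open>S i\<close> and \<open>S m\<close> through
    \<open>S' i\<close>.\<close>
  have sST: "s \<in> S i \<or> s \<in> S' i" if "i < m" for i
  proof -
    have "connected_in E (S i \<union> S' i)"
      using connected_in_Un S[of i] S'[of i] meet[of i i] sym that by auto
    then show ?thesis
      using s(2)[of "S i \<union> S' i"] S[of i] S'[of i] Sm[of i] S'm[of i] that by fastforce
  qed
  have other: "\<exists>j<m. j \<noteq> i" for i
    using m by (intro exI[of _ "if i = 0 then 1 else 0"]) auto
  show ?thesis
  proof (cases "\<exists>i<m. s \<in> S i")
    case False
    moreover have "s \<notin> S' m" using s(1) disj by blast
    ultimately show ?thesis
      using leaves_lower_bound_aux[OF g sym irr m, of S S' "S' m" s] S S' meet Sm sST by simp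
  next
    case True
    then obtain i where i: "i < m" "s \<in> S i" by blast
    \<comment> \<open>\<open>S' j\<close> misses \<open>S i\<close> for \<open>j\<close> different
      from \<open>i\<close>, so \<open>s\<close> can only be in \<open>S j\<close>.\<close>
    have "s \<in> S j" if "j < m" for j
      using i that meet[of i j] sST[of j] by blast
    \<comment> \<open>Now \<open>S j\<close> meets \<open>S m\<close> in \<open>s\<close>, and it
      meets \<open>S' m\<close> anyway, so it contains \<open>t\<close>.\<close>
    then have t': "t \<in> S j" if "j < m" for j
      using t(2)[of "S j"] S[of j] Sm[of j] s(1) that by auto
    then have "t \<notin> S' j" if "j < m" for j
      using other[of j] meet that by blast
    moreover have "t \<notin> S m" using t(1) disj by blast
    moreover have "S' i \<inter> S j \<noteq> {} \<longleftrightarrow> i = j" if "i < m" "j < m" for i j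
      using meet[of j i] that by blast
    ultimately show ?thesis
      using leaves_lower_bound_aux[OF g sym irr m, of S' S "S m" t] S S' S'm t' by simp
  qed
qed

section \<open>From library trees and subtrees to grown and connected sets\<close>

lemma pawalk_snoc:
  assumes "pcas u p w"
  shows "pcas u (p @ [(w, v)]) v" "pawalk_verts u (p @ [(w, v)]) = pawalk_verts u p @ [v]"
  using assms by (induction p arbitrary: u) auto

text \<open>Such a path closes up to a cycle when a new vertex has two neighbours in
  \<open>W\<close>. In the induction a path to or from the new vertex runs through its neighbour
  \<open>u\<close>.\<close>

lemma grown_path:
  assumes "grown E W" and sym: "sym E" and "x \<in> W" "y \<in> W"
  shows "\<exists>p. set p \<subseteq> E \<and> pcas x p y \<and> distinct (pawalk_verts x p) \<and> set (pawalk_verts x p) \<subseteq> W"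
  using assms(1,3-)
proof (induction arbitrary: x y rule: grown.induct)
  case (single a)
  then show ?case by (intro exI[of _ "[]"]) auto
next
  case (attach W u v)
  have vu: "(v, u) \<in> E" using symD[OF sym attach.hyps(4)] .
  consider "x \<in> W" "y \<in> W" | "x = v" "y = v" | "x = v" "y \<in> W" | "x \<in> W" "y = v"
    using attach.prems by blast
  then show ?case
  proof cases
    case 1
    then show ?thesis using attach.IH[of x y] by blast
  next
    case 2
    then show ?thesis by (intro exI[of _ "[]"]) auto
  next
    case 3
    obtain p where p: "set p \<subseteq> E" "pcas u p y" "distinct (pawalk_verts u p)"
      "set (pawalk_verts u p) \<subseteq> W"
      using attach.IH[of u y] 3 attach.hyps(2) by blast
    then show ?thesis
      using 3 vu attach.hyps(3) by (intro exI[of _ "(v, u) # p"]) auto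
  next
    case 4
    obtain p where p: "set p \<subseteq> E" "pcas x p u" "distinct (pawalk_verts x p)"
      "set (pawalk_verts x p) \<subseteq> W"
      using attach.IH[of x u] 4 attach.hyps(2) by blast
    then show ?thesis
      using 4 attach.hyps(3,4) pawalk_snoc[OF p(2), of v]
      by (intro exI[of _ "p @ [(u, v)]"]) auto
  qed
qed

text \<open>Reachability is taken in the symmetric closure, whose arcs are those of
  \<open>H\<close>, and a walk that leaves \<open>A\<close> has an arc that crosses the cut.\<close>

lemma connected_imp_connected_in:
  assumes sym: "sym (parcs H)" and con: "Digraph_Component.connected (with_proj H)"
  shows "connected_in (parcs H) (pverts H)"
proof -
  have arcs: "parcs (mk_symmetric (with_proj H)) = parcs H"
    "pverts (mk_symmetric (with_proj H)) = pverts H"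
    using symD[OF sym] by (auto simp: mk_symmetric_def)
  have reach: "(u, v) \<in> rtrancl_on (pverts H) (parcs H)" if "u \<in> pverts H" "v \<in> pverts H" for u v
    using con that arcs
    by (simp add: Digraph_Component.connected_def strongly_connected_def reachable_def)
  have cross: "\<exists>a\<in>A. \<exists>b\<in>pverts H - A. (a, b) \<in> parcs H"
    if "(u, v) \<in> rtrancl_on (pverts H) (parcs H)" "u \<in> A" "v \<notin> A" for u v A
    using that by (induction rule: rtrancl_on_induct) auto
  have "pverts H \<noteq> {}"
    using con arcs by (simp add: Digraph_Component.connected_def strongly_connected_def)
  moreover have "\<exists>a\<in>A. \<exists>b\<in>pverts H - A. (a, b) \<in> parcs H"
    if A: "A \<subset> pverts H" "A \<noteq> {}" for A
  proof -
    obtain u v where "u \<in> A" "v \<in> pverts H" "v \<notin> A" using A by blast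
    then show ?thesis using cross[of u v A] reach[of u v] A by blast
  qed
  ultimately show ?thesis unfolding connected_in_def by blast
qed

lemma pair_graph_sym_irrefl:
  assumes "pair_graph H"
  shows "sym (parcs H)" "irrefl (parcs H)"
proof -
  interpret pair_graph H by fact
  show "sym (parcs H)" using pair_sym_arcs by (simp add: symmetric_def)
  show "irrefl (parcs H)" using no_loops' by (auto simp: irrefl_def)
qed

lemma cycle_with_proj_iff:
  "pre_digraph.cycle (with_proj T) p \<longleftrightarrow>
    (\<exists>u\<in>pverts T. set p \<subseteq> parcs T \<and> pcas u p u \<and> distinct (tl (pawalk_verts u p)) \<and> p \<noteq> [])"
  by (auto simp: pre_digraph.cycle_def pre_digraph.awalk_def cas_with_proj_eq
      awalk_verts_with_proj_eq)

text \<open>A maximal grown subset \<open>W\<close> that is proper is left by an edge to some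
  \<open>v\<close>. A second neighbour of \<open>v\<close> in \<open>W\<close> would close a cycle
  with the path between the two neighbours; without one, \<open>v\<close> could be attached.\<close>

lemma undirected_tree_grown:
  assumes T: "undirected_tree T"
  shows "grown (parcs T) (pverts T)"
proof -
  let ?E = "parcs T" and ?V = "pverts T"
  have pg: "pair_graph T" and con: "Digraph_Component.connected (with_proj T)"
    and acyc: "\<And>p. pre_digraph.cycle (with_proj T) p \<Longrightarrow> length p < 3"
    using T by (auto simp: undirected_tree_def not_le[symmetric])
  interpret pair_graph T by fact
  note si = pair_graph_sym_irrefl[OF pg]
  have cV: "connected_in ?E ?V" by (rule connected_imp_connected_in[OF si(1) con])
  let ?\<W> = "{W. W \<subseteq> ?V \<and> grown ?E W}"
  have fin: "finite ?\<W>" using pair_finite_verts by simp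
  obtain x where "x \<in> ?V" using cV unfolding connected_in_def by blast
  then have "{x} \<in> ?\<W>" using grown.single[of ?E x] by blast
  then have "?\<W> \<noteq> {}" by blast
  from finite_has_maximal[OF fin this]
  obtain W where W: "W \<in> ?\<W>" "\<And>X. X \<in> ?\<W> \<Longrightarrow> W \<subseteq> X \<Longrightarrow> W = X" by metis
  show ?thesis
  proof (rule ccontr)
    assume "\<not> ?thesis"
    then have "W \<subset> ?V" using W by blast
    moreover have "W \<noteq> {}" using W(1) by (auto elim: grown.cases)
    ultimately obtain u v where uv: "u \<in> W" "v \<in> ?V" "v \<notin> W" "(u, v) \<in> ?E"
      using cV unfolding connected_in_def by blast
    have "w = u" if w: "w \<in> W" "(w, v) \<in> ?E" for w
    proof (rule ccontr)
      assume "w \<noteq> u"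
      obtain p where p: "set p \<subseteq> ?E" "pcas u p w" "distinct (pawalk_verts u p)"
        "set (pawalk_verts u p) \<subseteq> W"
        using grown_path[of ?E W u w] W(1) si(1) uv(1) w(1) by blast
      \<comment> \<open>As \<open>w\<close> differs from \<open>u\<close>, the path has an edge, and
        the cycle through \<open>v\<close> has length at least 3.\<close>
      have ne: "p \<noteq> []" using p(2) \<open>w \<noteq> u\<close> by auto
      have "pre_digraph.cycle (with_proj T) ((v, u) # p @ [(w, v)])"
        unfolding cycle_with_proj_iff
        using p uv w symD[OF si(1) uv(4)] pawalk_snoc[OF p(2), of v]
        by (intro bexI[of _ v]) auto
      from acyc[OF this] ne show False by (cases p) auto
    qed
    then have "insert v W \<in> ?\<W>" using W(1) uv grown.attach[of ?E W u v] by blast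
    from W(2)[OF this] show False using uv(3) by blast
  qed
qed

lemma leaves_eq_leaves_in:
  assumes "pair_graph T"
  shows "leaves T = leaves_in (parcs T) (pverts T)"
proof -
  interpret pair_graph T by fact
  have "out_degree (with_proj T) x = card {y. y \<in> pverts T \<and> (x, y) \<in> parcs T}" for x
  proof -
    have "out_arcs (with_proj T) x = Pair x ` {y. y \<in> pverts T \<and> (x, y) \<in> parcs T}"
      by (auto simp: out_arcs_def dest: in_arcsD2)
    then show ?thesis unfolding out_degree_def by (simp add: card_image inj_on_def)
  qed
  moreover have "card X = 1 \<longleftrightarrow> (\<exists>!y. y \<in> X)" for X :: "'a set"
    unfolding One_nat_def card_1_singleton_iff set_eq_iff singleton_iff by metis
  ultimately show ?thesis
    unfolding leaves_def leaves_in_def by simp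
qed

lemma subtree_of_connected_in:
  assumes "subtree_of H T"
  shows "connected_in (parcs T) (pverts H)" "pverts H \<subseteq> pverts T"
proof -
  have "parcs H \<subseteq> parcs T" "pverts H \<subseteq> pverts T"
    using assms by (auto simp: subtree_of_def subgraph_def)
  moreover have "connected_in (parcs H) (pverts H)"
    using assms pair_graph_sym_irrefl connected_imp_connected_in by (auto simp: subtree_of_def)
  ultimately show "connected_in (parcs T) (pverts H)" "pverts H \<subseteq> pverts T"
    using connected_in_mono by blast+
qed

section \<open>The leaves of a host tree for E_n\<close>

text \<open>Writing the number of vertices as \<open>Suc m\<close> makes \<open>m\<close> the
  special last vertex and avoids subtraction.\<close>

lemma E_digraph_arcs:
  "(u, v) \<in> parcs (E_digraph (Suc m)) \<longleftrightarrow>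
    u \<le> m \<and> v \<le> m \<and> (if u = m \<or> v = m then u \<noteq> v else u = v)"
  unfolding E_digraph_def E_matrix_def Let_def by (auto simp: less_Suc_eq_le split: if_splits)

lemma E_digraph_verts: "pverts (E_digraph n) = {..<n}"
  by (simp add: E_digraph_def)

lemma E_digraph_leaves_lower_bound:
  assumes T: "undirected_tree T" and rep: "subtree_representation (E_digraph (Suc m)) T S S'"
    and m: "2 \<le> m"
  shows "Suc m \<le> card (leaves T)"
proof -
  have pg: "pair_graph T" using T by (simp add: undirected_tree_def)
  note si = pair_graph_sym_irrefl[OF pg]
  have S: "connected_in (parcs T) (pverts (S i)) \<and> pverts (S i) \<subseteq> pverts T"
    and S': "connected_in (parcs T) (pverts (S' i)) \<and> pverts (S' i) \<subseteq> pverts T" if "i \<le> m" for i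
  proof -
    have "subtree_of (S i) T" "subtree_of (S' i) T"
      using rep that by (auto simp: subtree_representation_def E_digraph_verts)
    then show "connected_in (parcs T) (pverts (S i)) \<and> pverts (S i) \<subseteq> pverts T"
      "connected_in (parcs T) (pverts (S' i)) \<and> pverts (S' i) \<subseteq> pverts T"
      using subtree_of_connected_in by blast+
  qed
  have meet: "pverts (S i) \<inter> pverts (S' j) \<noteq> {} \<longleftrightarrow> (if i = m \<or> j = m then i \<noteq> j else i = j)"
    if "i \<le> m" "j \<le> m" for i j
    using rep that E_digraph_arcs[of i j m]
    by (simp add: subtree_representation_def E_digraph_verts less_Suc_eq_le)
  show ?thesis
    unfolding leaves_eq_leaves_in[OF pg]
  proof (rule leaves_lower_bound[OF undirected_tree_grown[OF T] si m, of "pverts \<circ> S" "pverts \<circ> S'"])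
    fix i assume "i < m"
    then show "(pverts \<circ> S') i \<inter> (pverts \<circ> S) m \<noteq> {}"
      using meet[of m i] by (auto simp: Int_commute)
  next
    show "(pverts \<circ> S) m \<inter> (pverts \<circ> S') m = {}" using meet[of m m] by simp
  qed (use S S' meet in simp_all)
qed

section \<open>The star as an optimal host\<close>

text \<open>With \<open>A\<close> empty this is a single vertex, so one construction gives the host
  and all its subtrees.\<close>

definition star :: "'t \<Rightarrow> 't set \<Rightarrow> 't pair_pre_digraph" where
  "star c A = \<lparr> pverts = insert c A, parcs = A \<times> {c} \<union> {c} \<times> A \<rparr>"

lemma star_simps [simp]:
  "pverts (star c A) = insert c A" "parcs (star c A) = A \<times> {c} \<union> {c} \<times> A"
  by (auto simp: star_def)

lemma pair_graph_star:
  assumes "finite A" "c \<notin> A"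
  shows "pair_graph (star c A)"
  using assms by unfold_locales (auto simp: symmetric_def sym_def)

lemma connected_star:
  assumes "finite A" "c \<notin> A"
  shows "Digraph_Component.connected (with_proj (star c A))"
proof -
  have arcs: "parcs (mk_symmetric (with_proj (star c A))) = parcs (star c A)"
    "pverts (mk_symmetric (with_proj (star c A))) = insert c A"
    by (auto simp: mk_symmetric_def)
  let ?R = "rtrancl_on (insert c A) (parcs (star c A))"
  have cv: "(c, v) \<in> ?R" if "v \<in> insert c A" for v
    using rtrancl_on_into_rtrancl_on[of c c "insert c A" _ v] that by (cases "v = c") auto
  have "(v, c) \<in> ?R" if "v \<in> insert c A" for v
    using rtrancl_on_into_rtrancl_on[of v v "insert c A" _ c] that by (cases "v = c") auto
  then have "(u, v) \<in> ?R" if "u \<in> insert c A" "v \<in> insert c A" for u v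
    using cv that rtrancl_on_trans by metis
  then show ?thesis
    unfolding Digraph_Component.connected_def strongly_connected_def reachable_def
    using arcs by simp
qed

text \<open>The vertices of a closed walk \<open>u\<close>, \<open>a\<close>, \<open>b\<close>,
  \<open>d\<close>, ... alternate between \<open>c\<close> and \<open>A\<close>. With at least three
  edges the centre is repeated after the start: at \<open>b\<close> and at the final
  \<open>u\<close> if \<open>u = c\<close>, at \<open>a\<close> and \<open>d\<close>
  otherwise.\<close>

lemma undirected_tree_star:
  assumes "finite A" "c \<notin> A"
  shows "undirected_tree (star c A)"
proof -
  have False if p: "pre_digraph.cycle (with_proj (star c A)) p" "3 \<le> length p" for p
  proof -
    from p(2) obtain e1 e2 e3 q where q: "p = e1 # e2 # e3 # q"
      by (metis Suc_le_length_iff numeral_3_eq_3)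
    obtain u where u: "set p \<subseteq> parcs (star c A)" "pcas u p u" "distinct (tl (pawalk_verts u p))"
      using p(1) unfolding cycle_with_proj_iff by blast
    have last: "z \<in> set (pawalk_verts y r)" if "pcas y r z" for y z and r :: "('a \<times> 'a) list"
      using that by (induction r arbitrary: y) auto
    have hd: "pcas y r z \<Longrightarrow> y \<in> set (pawalk_verts y r)" for y z and r :: "('a \<times> 'a) list"
      by (cases r) auto
    from u q obtain a b d where "e1 = (u, a)" "e2 = (a, b)" "e3 = (b, d)" "pcas d q u"
      by (cases e1; cases e2; cases e3) auto
    then show False
      using u q assms(2) last[of d q u] hd[of d q u] by auto
  qed
  then show ?thesis
    using pair_graph_star[OF assms] connected_star[OF assms] unfolding undirected_tree_def by blast
qed

text \<open>Two points of \<open>A\<close> keep the centre from being a leaf; with only one it would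
  be.\<close>

lemma leaves_star:
  assumes "finite A" "c \<notin> A" "2 \<le> card A"
  shows "leaves (star c A) = A"
proof -
  obtain a b where ab: "a \<in> A" "b \<in> A" "a \<noteq> b"
    using assms(3) card_le_Suc0_iff_eq[OF assms(1)] by force
  have "leaves_in (parcs (star c A)) (pverts (star c A)) = A"
    using assms(2) ab unfolding leaves_in_def by auto
  then show ?thesis by (simp only: leaves_eq_leaves_in[OF pair_graph_star[OF assms(1,2)]])
qed

lemma subtree_of_starI:
  assumes "finite A" "c \<notin> A" "finite B" "b \<notin> B"
    and "insert b B \<subseteq> insert c A" "parcs (star b B) \<subseteq> parcs (star c A)"
  shows "subtree_of (star b B) (star c A)"
proof -
  interpret A: pair_graph "star c A" using assms(1,2) by (rule pair_graph_star)
  interpret B: pair_graph "star b B" using assms(3,4) by (rule pair_graph_star)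
  have "subgraph (with_proj (star b B)) (with_proj (star c A))"
    using assms(5,6) A.wf_digraph B.wf_digraph by (intro subgraphI) auto
  then show ?thesis
    unfolding subtree_of_def using B.pair_graph connected_star[OF assms(3,4)] by blast
qed

lemma leafage_E_digraph:
  assumes "2 \<le> m"
  shows "leafage (E_digraph (Suc m)) = Suc m"
  unfolding leafage_def
proof (rule Least_equality)
  \<comment> \<open>Each \<open>?S u\<close> is the leaf \<open>u\<close>, so \<open>?S' v\<close>
    has to hold exactly the predecessors of \<open>v\<close> among the leaves; the centre
    \<open>Suc m\<close>, no vertex of the digraph, joins them.\<close>
  let ?T = "star (Suc m) {..m}"
  let ?S = "\<lambda>i. star i ({} :: nat set)"
  let ?S' = "\<lambda>i. star (Suc m) (if i = m then {..<m} else {i, m})"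
  have "subtree_representation (E_digraph (Suc m)) ?T ?S ?S'"
    unfolding subtree_representation_def
  proof (intro conjI ballI)
    fix v assume "v \<in> pverts (E_digraph (Suc m))"
    then have v: "v \<le> m" by (simp add: E_digraph_verts)
    then show "subtree_of (?S v) ?T" by (intro subtree_of_starI) auto
    show "subtree_of (?S' v) ?T" using v by (intro subtree_of_starI) auto
  next
    fix u v assume "u \<in> pverts (E_digraph (Suc m))" "v \<in> pverts (E_digraph (Suc m))"
    then show "(u, v) \<in> parcs (E_digraph (Suc m)) \<longleftrightarrow> pverts (?S u) \<inter> pverts (?S' v) \<noteq> {}"
      by (auto simp: E_digraph_verts E_digraph_arcs split: if_splits)
  qed
  moreover have "card (leaves ?T) = Suc m"
    using assms by (subst leaves_star) auto
  ultimately show "\<exists>(T :: nat pair_pre_digraph) S S'.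
     undirected_tree T \<and> card (leaves T) = Suc m \<and> subtree_representation (E_digraph (Suc m)) T S S'"
    using undirected_tree_star[of "{..m}" "Suc m"] by auto
qed (use E_digraph_leaves_lower_bound assms in blast)

section \<open>Both Ferrers dimensions of E_n\<close>

text \<open>This is the absence of a 2 by 2 permutation submatrix: otherwise \<open>b\<close> and
  \<open>d\<close> would show that the successor sets of \<open>a\<close> and \<open>c\<close> are
  incomparable.\<close>

lemma ferrers_digraph_on_arcs:
  assumes "ferrers_digraph_on V F" "(a, b) \<in> F" "(c, d) \<in> F"
  shows "(a, d) \<in> F \<or> (c, b) \<in> F"
proof -
  have "a \<in> V" "c \<in> V" using assms unfolding ferrers_digraph_on_def by blast+
  then show ?thesis using assms unfolding ferrers_digraph_on_def by blast
qed

text \<open>Complementing the successor sets inside \<open>V\<close> reverses their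
  inclusions.\<close>

lemma ferrers_digraph_on_complement:
  assumes "ferrers_digraph_on V F"
  shows "ferrers_digraph_on V (V \<times> V - F)"
  unfolding ferrers_digraph_on_def
proof (intro conjI ballI)
  fix u v assume "u \<in> V" "v \<in> V"
  then have "F `` {u} \<subseteq> F `` {v} \<or> F `` {v} \<subseteq> F `` {u}"
    using assms unfolding ferrers_digraph_on_def by blast
  then show "(V \<times> V - F) `` {u} \<subseteq> (V \<times> V - F) `` {v} \<or> (V \<times> V - F) `` {v} \<subseteq> (V \<times> V - F) `` {u}"
    using \<open>u \<in> V\<close> \<open>v \<in> V\<close> by blast
qed blast

lemma card_ge_3_of_cover:
  assumes "finite \<F>" "f0 \<in> \<F>" "f1 \<in> \<F>" "f2 \<in> \<F>" "f0 \<noteq> f1" "f0 \<noteq> f2" "f1 \<noteq> f2"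
  shows "3 \<le> card \<F>"
proof -
  have "card {f0, f1, f2} \<le> card \<F>" using assms by (intro card_mono) auto
  then show ?thesis using assms by simp
qed

text \<open>The members of the cover may overlap, so that the bound serves for both
  dimensions.\<close>

lemma ferrers_cover_complement_E_digraph:
  assumes m: "2 \<le> m" and fin: "finite \<F>" and fer: "\<forall>F\<in>\<F>. ferrers_digraph_on {..<Suc m} F"
    and cover: "\<Union>\<F> = complement_arcs (E_digraph (Suc m))"
  shows "3 \<le> card \<F>"
proof -
  have mem: "(u, v) \<in> \<Union>\<F> \<longleftrightarrow> u \<le> m \<and> v \<le> m \<and> (if u = m \<or> v = m then u = v else u \<noteq> v)" for u v
    unfolding cover complement_arcs_def by (auto simp: E_digraph_verts E_digraph_arcs)
  have "(0, 1) \<in> \<Union>\<F>" "(1, 0) \<in> \<Union>\<F>" "(m, m) \<in> \<Union>\<F>"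
    using m unfolding mem by auto
  then obtain F0 F1 F2 where F: "F0 \<in> \<F>" "F1 \<in> \<F>" "F2 \<in> \<F>" "(0, 1) \<in> F0" "(1, 0) \<in> F1" "(m, m) \<in> F2"
    by blast
  \<comment> \<open>For any two of the three chosen entries, these are the remaining corners of
    their rectangle, all of them edges of the digraph.\<close>
  have no: "(0, 0) \<notin> F" "(1, 1) \<notin> F" "(0, m) \<notin> F" "(m, 1) \<notin> F" "(1, m) \<notin> F" "(m, 0) \<notin> F"
    if "F \<in> \<F>" for F
    using mem[of 0 0] mem[of 1 1] mem[of 0 m] mem[of m 1] mem[of 1 m] mem[of m 0] m that by auto
  have "F0 \<noteq> F1" "F0 \<noteq> F2" "F1 \<noteq> F2"
    using F no fer ferrers_digraph_on_arcs by metis+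
  then show ?thesis by (rule card_ge_3_of_cover[OF fin F(1-3)])
qed

text \<open>By De Morgan the complements of the members form the cover. A bound on its size is
  enough to carry the lower bound over to intersections.\<close>

lemma ferrers_cover_of_intersection:
  assumes "finite \<F>" "\<forall>F\<in>\<F>. ferrers_digraph_on V F" "(V \<times> V) \<inter> \<Inter>\<F> = R"
  shows "\<exists>\<G>. finite \<G> \<and> card \<G> \<le> card \<F> \<and> (\<forall>F\<in>\<G>. ferrers_digraph_on V F) \<and> \<Union>\<G> = V \<times> V - R"
proof (intro exI conjI)
  let ?\<G> = "(\<lambda>F. V \<times> V - F) ` \<F>"
  show "\<forall>F\<in>?\<G>. ferrers_digraph_on V F"
    using assms(2) ferrers_digraph_on_complement by blast
  show "\<Union>?\<G> = V \<times> V - R" using assms(3) by blast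
qed (use assms(1) card_image_le in auto)

lemma ferrers_dims_E_digraph:
  assumes m: "2 \<le> m"
  shows "disjoint_ferrers_dim (E_digraph (Suc m)) = 3" "ferrers_dim (E_digraph (Suc m)) = 3"
proof -
  let ?D = "E_digraph (Suc m)"
  let ?V = "{..<Suc m}"
  define A B C where "A = {(i, j). i < j \<and> j < m}" and "B = {(i, j). j < i \<and> i < m}"
    and "C = {(m, m)}"
  note ABC = A_def B_def C_def
  \<comment> \<open>The rows of \<open>A\<close> shrink and the rows of \<open>B\<close> before row
    \<open>m\<close> grow with the index; row \<open>m\<close> of both is empty, and
    \<open>C\<close> has one nonempty row.\<close>
  have fer: "ferrers_digraph_on ?V F" if "F \<in> {A, B, C}" for F
    using that unfolding ferrers_digraph_on_def ABC by auto
  have mem: "(0, 1) \<in> A" "(0, 1) \<notin> B" "(0, 1) \<notin> C" "(1, 0) \<in> B" "(1, 0) \<notin> C"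
    using m by (auto simp: ABC)
  then have neq: "A \<noteq> B" "A \<noteq> C" "B \<noteq> C" by blast+
  have cover: "\<Union>{A, B, C} = complement_arcs ?D"
    unfolding complement_arcs_def ABC by (auto simp: E_digraph_verts E_digraph_arcs split: if_splits)
  have disj: "pairwise disjnt {A, B, C}"
    unfolding pairwise_def disjnt_def ABC by auto
  show "disjoint_ferrers_dim ?D = 3"
    unfolding disjoint_ferrers_dim_def
  proof (rule Least_equality)
    show "\<exists>\<F>. finite \<F> \<and> card \<F> = 3 \<and> (\<forall>F\<in>\<F>. ferrers_digraph_on (pverts ?D) F) \<and>
      pairwise disjnt \<F> \<and> \<Union>\<F> = complement_arcs ?D"
      using fer disj cover neq by (intro exI[of _ "{A, B, C}"]) (auto simp: E_digraph_verts)
  qed (use ferrers_cover_complement_E_digraph[OF m] in \<open>auto simp: E_digraph_verts\<close>)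
  show "ferrers_dim ?D = 3"
    unfolding ferrers_dim_def
  proof (rule Least_equality)
    let ?c = "\<lambda>F. ?V \<times> ?V - F"
    have sub: "F \<subseteq> ?V \<times> ?V" if "F \<in> {A, B, C}" for F
      using fer[OF that] unfolding ferrers_digraph_on_def by blast
    \<comment> \<open>Complementation inside the square is an involution, so the three complements
      remain distinct.\<close>
    have "inj_on ?c {A, B, C}"
      by (intro inj_onI) (metis double_diff sub subset_refl)
    then have "card (?c ` {A, B, C}) = 3"
      using neq by (subst card_image) auto
    moreover have "\<forall>F\<in>?c ` {A, B, C}. ferrers_digraph_on ?V F"
      using fer ferrers_digraph_on_complement by blast
    moreover have "(?V \<times> ?V) \<inter> \<Inter>(?c ` {A, B, C}) = ?V \<times> ?V - \<Union>{A, B, C}" by blast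
    moreover have "parcs ?D \<subseteq> ?V \<times> ?V"
      by (auto simp: E_digraph_arcs)
    then have "?V \<times> ?V - complement_arcs ?D = parcs ?D"
      unfolding complement_arcs_def E_digraph_verts by blast
    ultimately show "\<exists>\<F>. finite \<F> \<and> card \<F> = 3 \<and> (\<forall>F\<in>\<F>. ferrers_digraph_on (pverts ?D) F) \<and>
      (pverts ?D \<times> pverts ?D) \<inter> \<Inter>\<F> = parcs ?D"
      unfolding E_digraph_verts cover by (intro exI[of _ "?c ` {A, B, C}"]) simp
  next
    fix k
    assume "\<exists>\<F>. finite \<F> \<and> card \<F> = k \<and> (\<forall>F\<in>\<F>. ferrers_digraph_on (pverts ?D) F) \<and>
      (pverts ?D \<times> pverts ?D) \<inter> \<Inter>\<F> = parcs ?D"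
    then obtain \<F> where F: "finite \<F>" "card \<F> = k" "\<forall>F\<in>\<F>. ferrers_digraph_on ?V F"
      "(?V \<times> ?V) \<inter> \<Inter>\<F> = parcs ?D"
      unfolding E_digraph_verts by blast
    obtain \<G> where "finite \<G>" "card \<G> \<le> k" "\<forall>F\<in>\<G>. ferrers_digraph_on ?V F"
      "\<Union>\<G> = complement_arcs ?D"
      using ferrers_cover_of_intersection[OF F(1,3,4)] F(2)
      unfolding complement_arcs_def E_digraph_verts by blast
    then show "3 \<le> k"
      using ferrers_cover_complement_E_digraph[OF m, of \<G>] by simp
  qed
qed

theorem theorem4:
  shows "(\<not> (\<exists>g :: nat \<Rightarrow> nat. \<forall>D :: nat pair_pre_digraph.
            finite_nonempty_digraph D \<and> 3 \<le> disjoint_ferrers_dim D \<longrightarrow>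
            leafage D \<le> g (disjoint_ferrers_dim D))) \<and>
         (\<forall>n \<ge> 3. leafage (E_digraph n) = n \<and>
            disjoint_ferrers_dim (E_digraph n) = 3 \<and> ferrers_dim (E_digraph n) = 3)"
proof
  have E: "leafage (E_digraph n) = n \<and>
      disjoint_ferrers_dim (E_digraph n) = 3 \<and> ferrers_dim (E_digraph n) = 3" if "3 \<le> n" for n
    using that leafage_E_digraph[of "n - 1"] ferrers_dims_E_digraph[of "n - 1"] by simp
  then show "\<forall>n \<ge> 3. leafage (E_digraph n) = n \<and>
      disjoint_ferrers_dim (E_digraph n) = 3 \<and> ferrers_dim (E_digraph n) = 3" by blast
  show "\<not> (\<exists>g :: nat \<Rightarrow> nat. \<forall>D :: nat pair_pre_digraph.
      finite_nonempty_digraph D \<and> 3 \<le> disjoint_ferrers_dim D \<longrightarrow>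
      leafage D \<le> g (disjoint_ferrers_dim D))"
  proof
    assume "\<exists>g :: nat \<Rightarrow> nat. \<forall>D :: nat pair_pre_digraph.
      finite_nonempty_digraph D \<and> 3 \<le> disjoint_ferrers_dim D \<longrightarrow>
      leafage D \<le> g (disjoint_ferrers_dim D)"
    then obtain g :: "nat \<Rightarrow> nat" where
      g: "\<And>D :: nat pair_pre_digraph. finite_nonempty_digraph D \<Longrightarrow> 3 \<le> disjoint_ferrers_dim D \<Longrightarrow>
        leafage D \<le> g (disjoint_ferrers_dim D)" by blast
    \<comment> \<open>The summand 3 makes \<open>?n\<close> large enough for the second part and
      larger than \<open>g 3\<close>.\<close>
    let ?n = "g 3 + 3"
    have "leafage (E_digraph ?n) \<le> g 3"
      using g[OF finite_nonempty_E_digraph, of ?n] E[of ?n] by simp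
    then show False using E[of ?n] by simp
  qed
qed

end
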